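(* Let $s\in\mathbb{N}$ and let $u$ be a subset of $[1:s]=\{1,\ldots,s\}$ with $\emptyset\ne u\subsetneq[1:s]$. Let $F$ be a linear space of real-valued functions on a domain $D\subseteq\mathbb{R}^s$ and let $P_1,\ldots,P_s$ be commuting projections on $F$ as described in the context. Then a function $f\in F$ is separable with respect to $\boldsymbol{x}_u$ and $\boldsymbol{x}_{-u}$ if and only if \[ \left(I+P_{[1:s]}-P_u-P_{-u}\right)(f)=0 . \]
   Context: Notation: $\boldsymbol{x}=(x_1,\ldots,x_s)$; for $u\subseteq[1:s]$, $\boldsymbol{x}_u=(x_j)_{j\in u}$ and $-u=[1:s]\setminus u$. Setting: $F$ is a linear space of real-valued functions defined on $D\subseteq\mathbb{R}^s$. $\{P_j: j=1,\ldots,s\}$ is a set of commuting projections on $F$ such that, for every $f\in F$, $P_j(f)$ does not depend on $x_j$, and $P_j(f)=f$ whenever $f$ does not depend on $x_j$. Put $P_u=\prod_{j\in u}P_j$ for $\emptyset\ne u\subseteq[1:s]$, and $P_\emptyset=I$ (the identity operator). For every $u\subseteq[1:s]$ and $f\in F$, the function $P_u(f)$ depends only on $\boldsymbol{x}_{-u}$ (in particular $P_{[1:s]}(f)$ is a constant). Separability: $f$ is separable with respect to $\boldsymbol{x}_u$ and $\boldsymbol{x}_{-u}$ if there exist functions $g_1$ and $g_2$ such that $f(\boldsymbol{x})=g_1(\boldsymbol{x}_u)+g_2(\boldsymbol{x}_{-u})$ holds for any $\boldsymbol{x}\in D$.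
   Formalization: Separability is taken with both components g_1(x_u) and g_2(x_{-u}), as functions on D, belonging to F; with arbitrary g_1, g_2 the "only if" part fails (F spanned by 1 and x_1+x_2 on R^2, P_1=P_2 mapping a+b(x_1+x_2) to a, f=x_1+x_2). *)

theory Defs
  imports "HOL-Analysis.Analysis" "HOL-Library.Function_Algebras"
begin

text \<open>
  The index set \<open>[1:s]\<close> is the universe of a finite type \<open>'n\<close> with \<open>s = CARD('n)\<close>, so
  that \<open>- u\<close> is the complement of \<open>u\<close> in \<open>[1:s]\<close>.  A real-valued function on \<open>D\<close> is
  represented by its extension by \<open>0\<close> to all of \<open>real ^ 'n\<close>.  This representation is one-to-one
  and compatible with the pointwise operations of \<^theory>\<open>HOL-Library.Function_Algebras\<close>.
\<close>

definition fun_on :: "(real ^ 'n) set \<Rightarrow> (real ^ 'n \<Rightarrow> real) \<Rightarrow> (real ^ 'n \<Rightarrow> real)" where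
  "fun_on D h = (\<lambda>x. if x \<in> D then h x else 0)"

definition subvec :: "real ^ 'n \<Rightarrow> 'n set \<Rightarrow> ('n \<Rightarrow> real)" where
  "subvec x w = (\<lambda>j\<in>w. x $ j)"

definition depends_only_on :: "(real ^ 'n) set \<Rightarrow> 'n set \<Rightarrow> (real ^ 'n \<Rightarrow> real) \<Rightarrow> bool" where
  "depends_only_on D w f \<longleftrightarrow> (\<exists>g. \<forall>x\<in>D. f x = g (subvec x w))"

abbreviation not_depends_on :: "(real ^ 'n) set \<Rightarrow> 'n \<Rightarrow> (real ^ 'n \<Rightarrow> real) \<Rightarrow> bool" where
  "not_depends_on D j f \<equiv> depends_only_on D (- {j}) f"

text \<open>
  The composition of the operators \<open>P j\<close>, \<open>j \<in> u\<close>.  They need to commute only on \<open>F\<close>, and for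
  arguments in \<open>F\<close> this is enough for the result not to depend on the order; see \<open>prod_op_insert\<close>
  and \<open>prod_op_in\<close> below.
\<close>

definition prod_op :: "('n \<Rightarrow> 'f \<Rightarrow> 'f) \<Rightarrow> 'n set \<Rightarrow> 'f \<Rightarrow> 'f" where
  "prod_op P u f = Finite_Set.fold P f u"

locale commuting_projections =
  fixes D :: "(real ^ 'n) set"
    and F :: "(real ^ 'n \<Rightarrow> real) set"
    and P :: "'n \<Rightarrow> (real ^ 'n \<Rightarrow> real) \<Rightarrow> (real ^ 'n \<Rightarrow> real)"
  assumes on_D: "f \<in> F \<Longrightarrow> x \<notin> D \<Longrightarrow> f x = 0"
    and zero_in: "0 \<in> F"
    and add_in: "f \<in> F \<Longrightarrow> g \<in> F \<Longrightarrow> f + g \<in> F"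
    and scale_in: "f \<in> F \<Longrightarrow> (\<lambda>x. c * f x) \<in> F"
    and P_in: "f \<in> F \<Longrightarrow> P j f \<in> F"
    and P_add: "f \<in> F \<Longrightarrow> g \<in> F \<Longrightarrow> P j (f + g) = P j f + P j g"
    and P_scale: "f \<in> F \<Longrightarrow> P j (\<lambda>x. c * f x) = (\<lambda>x. c * P j f x)"
    and P_idem: "f \<in> F \<Longrightarrow> P j (P j f) = P j f"
    and P_commute: "f \<in> F \<Longrightarrow> P j (P k f) = P k (P j f)"
    and P_not_depends: "f \<in> F \<Longrightarrow> not_depends_on D j (P j f)"
    and P_fixes: "f \<in> F \<Longrightarrow> not_depends_on D j f \<Longrightarrow> P j f = f"

text \<open>
  For an arbitrary \<open>D\<close>, not depending on each of the variables \<open>x\<^sub>j\<close>, \<open>j \<in> u\<close>, separately does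
  not imply depending only on the remaining variables jointly (e.g. if no two points of \<open>D\<close> differ
  in exactly one coordinate), so the latter is a condition in its own right.  It is automatic
  if \<open>D\<close> is a product; see \<open>anova_setting_product_domain\<close> below.
\<close>

locale anova_setting = commuting_projections D F P
  for D :: "(real ^ 'n) set" and F P +
  assumes prod_op_depends: "f \<in> F \<Longrightarrow> depends_only_on D (- u) (prod_op P u f)"

text \<open>
  The two components are functions of the space \<open>F\<close> under consideration.  Without this the
  projections carry no information about them: for \<open>D = real ^ 2\<close>, let \<open>F\<close> be spanned by \<open>1\<close> and
  \<open>x\<^sub>1 + x\<^sub>2\<close>, and let \<open>P 1 = P 2\<close> map \<open>a + b (x\<^sub>1 + x\<^sub>2)\<close> to \<open>a\<close>.  These are commuting projections
  as required, but \<open>f = x\<^sub>1 + x\<^sub>2\<close> satisfies \<open>f + P\<^sub>1 (P\<^sub>2 f) - P\<^sub>1 f - P\<^sub>2 f = f\<close>, which is not \<open>0\<close>.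
\<close>

definition separable_wrt ::
  "(real ^ 'n) set \<Rightarrow> (real ^ 'n \<Rightarrow> real) set \<Rightarrow> 'n set \<Rightarrow> (real ^ 'n \<Rightarrow> real) \<Rightarrow> bool" where
  "separable_wrt D F u f \<longleftrightarrow>
     (\<exists>g\<^sub>1 g\<^sub>2. fun_on D (\<lambda>x. g\<^sub>1 (subvec x u)) \<in> F \<and>
              fun_on D (\<lambda>x. g\<^sub>2 (subvec x (- u))) \<in> F \<and>
              (\<forall>x\<in>D. f x = g\<^sub>1 (subvec x u) + g\<^sub>2 (subvec x (- u))))"

lemma prod_op_empty: "prod_op P {} = id"
  by (simp add: prod_op_def fun_eq_iff)

context commuting_projections
begin

lemma fold_restrict:
  assumes "f \<in> F"
  shows "Finite_Set.fold P f u = Finite_Set.fold (\<lambda>j g. if g \<in> F then P j g else g) f u"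
  by (rule fold_closed_eq[where B = F]) (use assms P_in in auto)

interpretation restr: comp_fun_commute "\<lambda>j g. if g \<in> F then P j g else g"
  by standard (auto simp: fun_eq_iff P_in P_commute)

lemma prod_op_in:
  assumes "f \<in> F"
  shows "prod_op P u f \<in> F"
proof -
  have "finite u" by simp
  then show ?thesis
    unfolding prod_op_def fold_restrict[OF assms]
    by induction (use assms P_in in auto)
qed

lemma prod_op_insert:
  assumes "f \<in> F" "j \<notin> u"
  shows "prod_op P (insert j u) f = P j (prod_op P u f)"
  using prod_op_in[OF assms(1), of u] assms(2)
  unfolding prod_op_def fold_restrict[OF assms(1)] by simp

lemma anova_setting_product_domain:
  fixes E :: "'n \<Rightarrow> real set"
  assumes D: "D = {x. \<forall>i. x $ i \<in> E i}"
  shows "anova_setting D F P"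
proof
  have iff: "depends_only_on D w f \<longleftrightarrow> (\<forall>x\<in>D. \<forall>y\<in>D. (\<forall>i\<in>w. x $ i = y $ i) \<longrightarrow> f x = f y)"
    (is "_ \<longleftrightarrow> ?R") for w f
  proof
    assume "depends_only_on D w f"
    then obtain g where g: "\<forall>x\<in>D. f x = g (subvec x w)"
      by (auto simp: depends_only_on_def)
    have "subvec x w = subvec y w" if "\<forall>i\<in>w. x $ i = y $ i" for x y :: "real ^ 'n"
      using that by (auto simp: subvec_def restrict_def fun_eq_iff)
    with g show ?R by metis
  next
    assume R: ?R
    have "f x = f (SOME y. y \<in> D \<and> subvec y w = subvec x w)" if "x \<in> D" for x
    proof -
      define y where "y = (SOME y. y \<in> D \<and> subvec y w = subvec x w)"
      have y: "y \<in> D \<and> subvec y w = subvec x w"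
        unfolding y_def by (rule someI[of _ x]) (use that in auto)
      then have "\<forall>i\<in>w. x $ i = y $ i"
        by (metis restrict_apply' subvec_def)
      with R y that show ?thesis unfolding y_def[symmetric] by blast
    qed
    then show "depends_only_on D w f"
      unfolding depends_only_on_def
      by (intro exI[of _ "\<lambda>v. f (SOME y. y \<in> D \<and> subvec y w = v)"]) auto
  qed
  have depD: "f x = f y"
    if "depends_only_on D w f" "x \<in> D" "y \<in> D" "\<forall>i\<in>w. x $ i = y $ i" for w f x y
    using that unfolding iff by blast
  have inter: "depends_only_on D (A \<inter> B) f"
    if A: "depends_only_on D A f" and B: "depends_only_on D B f" for A B f
    unfolding iff
  proof (intro ballI impI)
    fix x y assume xy: "x \<in> D" "y \<in> D" "\<forall>i\<in>A \<inter> B. x $ i = y $ i"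
    define z where "z = (\<chi> i. if i \<in> A then x $ i else y $ i)"
    have "z \<in> D" using xy D by (auto simp: z_def)
    moreover have "f x = f z" by (rule depD[OF A]) (use xy \<open>z \<in> D\<close> in \<open>auto simp: z_def\<close>)
    moreover have "f z = f y" by (rule depD[OF B]) (use xy \<open>z \<in> D\<close> in \<open>auto simp: z_def\<close>)
    ultimately show "f x = f y" by simp
  qed
  have each: "not_depends_on D j (prod_op P u f)" if "f \<in> F" "j \<in> u" for j u f
    using prod_op_insert[of f j "u - {j}"] that P_not_depends[OF prod_op_in]
    by (simp add: insert_absorb)
  have "depends_only_on D (- v) (prod_op P u f)" if f: "f \<in> F" and "v \<subseteq> u" for u v f
  proof -
    have "finite v" by simp
    then show ?thesis using \<open>v \<subseteq> u\<close>
    proof induction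
      case empty
      show ?case unfolding iff by (metis Compl_empty_eq UNIV_I vec_eq_iff)
    next
      case (insert j v)
      then have "depends_only_on D (- {j} \<inter> - v) (prod_op P u f)"
        by (intro inter each[OF f]) auto
      moreover have "- {j} \<inter> - v = - insert j v" by blast
      ultimately show ?case by simp
    qed
  qed
  then show "depends_only_on D (- u) (prod_op P u f)" if "f \<in> F" for u f
    using that by blast
qed

end

end

theory Submission
  imports Defs
begin

text \<open>
  A member of \<open>F\<close> that depends only on \<open>x\<^sub>-\<^sub>u\<close> is fixed by \<open>P\<^sub>u\<close>.  Since \<open>P\<^bsub>[1:s]\<^esub> = P\<^sub>u P\<^sub>-\<^sub>u = P\<^sub>-\<^sub>u P\<^sub>u\<close>, the
  operator \<open>I + P\<^bsub>[1:s]\<^esub> - P\<^sub>u - P\<^sub>-\<^sub>u\<close> is additive and annihilates both kinds of components.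
  Conversely, if it annihilates \<open>f\<close>, then \<open>f = (P\<^sub>-\<^sub>u f - P\<^bsub>[1:s]\<^esub> f) + P\<^sub>u f\<close> is a separation.
\<close>

lemma depends_only_on_mono:
  assumes "depends_only_on D v f" and "v \<subseteq> w"
  shows "depends_only_on D w f"
proof -
  obtain g where "\<forall>x\<in>D. f x = g (subvec x v)"
    using assms(1) by (auto simp: depends_only_on_def)
  \<comment> \<open>The witness for \<open>w\<close> is \<open>g\<close> precomposed with
    restriction to \<open>v\<close>.\<close>
  moreover have "subvec x v = restrict (subvec x w) v" for x
    using \<open>v \<subseteq> w\<close> by (auto simp: subvec_def fun_eq_iff)
  ultimately have "\<forall>x\<in>D. f x = g (restrict (subvec x w) v)" by simp
  then show ?thesis
    unfolding depends_only_on_def by (intro exI[of _ "\<lambda>y. g (restrict y v)"])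
qed

lemma depends_only_on_diff:
  assumes "depends_only_on D w f" and "depends_only_on D w g"
  shows "depends_only_on D w (f - g)"
proof -
  obtain a b where "\<forall>x\<in>D. f x = a (subvec x w)" "\<forall>x\<in>D. g x = b (subvec x w)"
    using assms by (auto simp: depends_only_on_def)
  then show ?thesis
    unfolding depends_only_on_def by (intro exI[of _ "\<lambda>y. a y - b y"]) simp
qed

lemma depends_only_on_fun_on: "depends_only_on D w (fun_on D (\<lambda>x. g (subvec x w)))"
  by (auto simp: depends_only_on_def fun_on_def)

context commuting_projections
begin

lemma diff_in:
  assumes "f \<in> F" and "g \<in> F"
  shows "f - g \<in> F"
proof -
  have "f - g = f + (\<lambda>x. (- 1) * g x)" by (simp add: fun_eq_iff)
  then show ?thesis using add_in scale_in assms by metis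
qed

text \<open>Members of \<open>F\<close> vanish off \<open>D\<close>, so agreement on
  \<open>D\<close> is already equality of functions.\<close>

lemma depends_only_on_iff_fun_on:
  assumes "f \<in> F"
  shows "depends_only_on D w f \<longleftrightarrow> (\<exists>g. f = fun_on D (\<lambda>x. g (subvec x w)))"
  using on_D[OF assms] by (auto simp: depends_only_on_def fun_on_def fun_eq_iff)

text \<open>This turns the components into members of \<open>F\<close>, to which the operators
  apply. On the left, \<open>f \<in> F\<close> makes \<open>f\<close> vanish off \<open>D\<close>,
  so the equation on \<open>D\<close> becomes one of functions.\<close>

lemma separable_wrt_iff:
  "separable_wrt D F u f \<and> f \<in> F \<longleftrightarrow>
    (\<exists>f\<^sub>1\<in>F. \<exists>f\<^sub>2\<in>F. depends_only_on D u f\<^sub>1 \<and> depends_only_on D (- u) f\<^sub>2 \<and> f = f\<^sub>1 + f\<^sub>2)"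
  (is "?L \<longleftrightarrow> ?R")
proof
  assume L: ?L
  then obtain g\<^sub>1 g\<^sub>2 where g: "fun_on D (\<lambda>x. g\<^sub>1 (subvec x u)) \<in> F"
      "fun_on D (\<lambda>x. g\<^sub>2 (subvec x (- u))) \<in> F"
      and sum: "\<forall>x\<in>D. f x = g\<^sub>1 (subvec x u) + g\<^sub>2 (subvec x (- u))"
    by (auto simp: separable_wrt_def)
  have "f = fun_on D (\<lambda>x. g\<^sub>1 (subvec x u)) + fun_on D (\<lambda>x. g\<^sub>2 (subvec x (- u)))"
    using sum on_D L by (auto simp: fun_on_def fun_eq_iff)
  with g show ?R using depends_only_on_fun_on by blast
next
  assume ?R
  then obtain f\<^sub>1 f\<^sub>2 where f: "f\<^sub>1 \<in> F" "f\<^sub>2 \<in> F" "f = f\<^sub>1 + f\<^sub>2"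
    and dep: "depends_only_on D u f\<^sub>1" "depends_only_on D (- u) f\<^sub>2" by blast
  obtain g\<^sub>1 g\<^sub>2 where g: "f\<^sub>1 = fun_on D (\<lambda>x. g\<^sub>1 (subvec x u))"
      "f\<^sub>2 = fun_on D (\<lambda>x. g\<^sub>2 (subvec x (- u)))"
    using dep f depends_only_on_iff_fun_on by metis
  have "\<forall>x\<in>D. f x = g\<^sub>1 (subvec x u) + g\<^sub>2 (subvec x (- u))"
    unfolding \<open>f = f\<^sub>1 + f\<^sub>2\<close> g by (simp add: fun_on_def)
  then show ?L
    using f add_in unfolding separable_wrt_def g by blast
qed

lemma prod_op_add:
  assumes "f \<in> F" and "g \<in> F"
  shows "prod_op P u (f + g) = prod_op P u f + prod_op P u g"
  using finite[of u]
proof induction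
  case empty
  show ?case by (simp add: prod_op_empty)
next
  case (insert j u)
  then show ?case
    using assms by (simp only: prod_op_insert add_in prod_op_in P_add not_False_eq_True)
qed

text \<open>Disjointness ensures that each \<open>j\<close> taken from \<open>u\<close> is new to
  the rest of the union, as \<open>prod_op_insert\<close> requires.\<close>

lemma prod_op_Un:
  assumes "f \<in> F" and "u \<inter> v = {}"
  shows "prod_op P (u \<union> v) f = prod_op P u (prod_op P v f)"
  using finite[of u] assms(2)
proof induction
  case empty
  show ?case by (simp add: prod_op_empty)
next
  case (insert j u)
  then show ?case
    using assms(1) by (simp add: prod_op_insert prod_op_in)
qed

lemma prod_op_UNIV:
  assumes "f \<in> F"
  shows "prod_op P UNIV f = prod_op P u (prod_op P (- u) f)"
  using prod_op_Un[OF assms, of u "- u"] by simp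

text \<open>The complement of \<open>insert j u\<close> lies in both \<open>- {j}\<close> and
  \<open>- u\<close>. Monotonicity thus yields both the premise of \<open>P_fixes\<close> and that
  of the induction hypothesis.\<close>

lemma prod_op_fixes:
  assumes "f \<in> F" and "depends_only_on D (- u) f"
  shows "prod_op P u f = f"
  using finite[of u] assms(2)
proof induction
  case empty
  show ?case by (simp add: prod_op_empty)
next
  case (insert j u)
  have "not_depends_on D j f" "depends_only_on D (- u) f"
    by (rule depends_only_on_mono[OF insert.prems]; blast)+
  then show ?case
    using insert.IH insert.hyps assms(1) by (simp add: prod_op_insert P_fixes)
qed

text \<open>By \<open>prod_op_UNIV\<close> and additivity, on \<open>F\<close> this is the product
  of \<open>I - P_u\<close> and \<open>I - P_(-u)\<close>.\<close>

abbreviation interaction_op :: "'n set \<Rightarrow> (real ^ 'n \<Rightarrow> real) \<Rightarrow> (real ^ 'n \<Rightarrow> real)" where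
  "interaction_op u \<equiv> id + prod_op P UNIV - prod_op P u - prod_op P (- u)"

lemma interaction_op_add:
  assumes "f \<in> F" and "g \<in> F"
  shows "interaction_op u (f + g) = interaction_op u f + interaction_op u g"
  using prod_op_add[OF assms] by (simp add: fun_eq_iff)

text \<open>Since \<open>P_u\<close> fixes \<open>f\<close>, the full product
  \<open>P_(-u) (P_u f)\<close> is \<open>P_(-u) f\<close>, and the four terms cancel in
  pairs.\<close>

lemma interaction_op_eq_0:
  assumes "f \<in> F" and "depends_only_on D (- u) f"
  shows "interaction_op u f = 0"
  using prod_op_UNIV[OF assms(1), of "- u"] prod_op_fixes[OF assms] by simp

end

theorem corollary1:
  fixes D :: "(real ^ 'n) set"
    and F :: "(real ^ 'n \<Rightarrow> real) set"
    and P :: "'n \<Rightarrow> (real ^ 'n \<Rightarrow> real) \<Rightarrow> (real ^ 'n \<Rightarrow> real)"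
    and u :: "'n set"
    and f :: "real ^ 'n \<Rightarrow> real"
  assumes "anova_setting D F P"
    and "u \<noteq> {}" and "u \<subset> UNIV"
    and "f \<in> F"
  shows "separable_wrt D F u f \<longleftrightarrow>
         (id + prod_op P UNIV - prod_op P u - prod_op P (- u)) f = 0"
proof -
  interpret anova_setting D F P by fact
  show ?thesis
  proof
    assume "separable_wrt D F u f"
    then obtain f\<^sub>1 f\<^sub>2 where f: "f\<^sub>1 \<in> F" "f\<^sub>2 \<in> F" "f = f\<^sub>1 + f\<^sub>2"
      and dep: "depends_only_on D u f\<^sub>1" "depends_only_on D (- u) f\<^sub>2"
      using separable_wrt_iff \<open>f \<in> F\<close> by metis
    \<comment> \<open>The operator is symmetric in \<open>u\<close> and \<open>- u\<close>, so the
      lemma for the complement also handles the component in the variables of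
      \<open>u\<close>.\<close>
    have "interaction_op (- u) f\<^sub>1 = 0"
      using f dep by (intro interaction_op_eq_0) simp_all
    then have "interaction_op u f\<^sub>1 = 0"
      by (simp add: algebra_simps)
    moreover have "interaction_op u f\<^sub>2 = 0"
      using f dep by (intro interaction_op_eq_0)
    ultimately show "interaction_op u f = 0"
      unfolding \<open>f = f\<^sub>1 + f\<^sub>2\<close> interaction_op_add[OF f(1,2)] by simp
  next
    assume eq: "interaction_op u f = 0"
    let ?f\<^sub>1 = "prod_op P (- u) f - prod_op P UNIV f"
    have "f = ?f\<^sub>1 + prod_op P u f"
      using eq by (simp add: algebra_simps)
    moreover have "depends_only_on D u ?f\<^sub>1"
      \<comment> \<open>\<open>P_UNIV f\<close> depends only on the empty set of variables, hence by
        monotonicity only on those of \<open>u\<close>.\<close>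
      using prod_op_depends[OF \<open>f \<in> F\<close>, of "- u"] prod_op_depends[OF \<open>f \<in> F\<close>, of UNIV]
      by (intro depends_only_on_diff) (auto intro: depends_only_on_mono)
    moreover have "?f\<^sub>1 \<in> F" "prod_op P u f \<in> F"
      using \<open>f \<in> F\<close> by (auto intro: diff_in prod_op_in)
    ultimately show "separable_wrt D F u f"
      using separable_wrt_iff prod_op_depends[OF \<open>f \<in> F\<close>] by blast
  qed
qed

end
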